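(* Let $b>0$ and let $t\mapsto\alpha(t)$ be a continuous function on $[0,\infty)$ with $\alpha(t)\in(0,1)$ for all $t\ge0$. Let $G^I_{\alpha,-\alpha}$ be the first-type inhomogeneous geometric stable subordinator. Then its time-dependent Lévy measure is, for each $t\ge0$, $$\nu_t^{G^I_{\alpha,-\alpha}}(dx)=x^{-1}\alpha(t)\,E_{\alpha(t)}\big(-x^{\alpha(t)}/b\big)\,dx,\qquad x>0.$$
   Context: $G^I_{\alpha,-\alpha}$ is the non-decreasing additive process (stochastically continuous, started at $0$, independent increments) with $$\mathbb{E}e^{-\lambda (G^I_{\alpha,-\alpha}(t)-G^I_{\alpha,-\alpha}(s))}=\exp\Big(-\int_s^t\ln(1+b\lambda^{\alpha(\tau)})\,d\tau\Big),\qquad \lambda>0,\ 0\le s\le t.$$ Its time-dependent Lévy measure is the family of measures $\nu_t$ on $(0,\infty)$ satisfying $\int_0^\infty\frac{x}{1+x}\nu_t(dx)<\infty$ and $$\ln(1+b\lambda^{\alpha(t)})=\int_0^\infty(1-e^{-\lambda x})\,\nu_t(dx),\qquad\lambda>0.$$ $E_\alpha(x)=\sum_{j=0}^\infty\frac{x^j}{\Gamma(\alpha j+1)}$ is the Mittag-Leffler function. *)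

theory Defs
  imports "HOL-Probability.Probability"
begin

definition mittag_leffler :: "real \<Rightarrow> real \<Rightarrow> real" where
  "mittag_leffler a x = (\<Sum>j. x ^ j / Gamma (a * real j + 1))"

definition stochastically_continuous :: "'a measure \<Rightarrow> (real \<Rightarrow> 'a \<Rightarrow> real) \<Rightarrow> bool" where
  "stochastically_continuous M X \<longleftrightarrow>
     (\<forall>t\<ge>0. \<forall>e>0.
        ((\<lambda>s. measure M {\<omega> \<in> space M. \<bar>X s \<omega> - X t \<omega>\<bar> > e}) \<longlongrightarrow> 0) (at t within {0..}))"

definition independent_increments :: "'a measure \<Rightarrow> (real \<Rightarrow> 'a \<Rightarrow> real) \<Rightarrow> bool" where
  "independent_increments M X \<longleftrightarrow>
     (\<forall>n (ts :: nat \<Rightarrow> real). 0 \<le> ts 0 \<longrightarrow> mono ts \<longrightarrow>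
        prob_space.indep_vars M (\<lambda>_. borel) (\<lambda>i \<omega>. X (ts (Suc i)) \<omega> - X (ts i) \<omega>) {..<n})"

text \<open>Processes are indexed by \<open>[0,\<infinity>)\<close>; values at negative times are never constrained.\<close>

definition additive_process :: "'a measure \<Rightarrow> (real \<Rightarrow> 'a \<Rightarrow> real) \<Rightarrow> bool" where
  "additive_process M X \<longleftrightarrow>
     prob_space M \<and>
     (\<forall>t\<ge>0. X t \<in> borel_measurable M) \<and>
     (AE \<omega> in M. X 0 \<omega> = 0) \<and>
     independent_increments M X \<and>
     stochastically_continuous M X"

definition nondecreasing_paths :: "'a measure \<Rightarrow> (real \<Rightarrow> 'a \<Rightarrow> real) \<Rightarrow> bool" where
  "nondecreasing_paths M X \<longleftrightarrow> (AE \<omega> in M. \<forall>s\<ge>0. \<forall>t\<ge>s. X s \<omega> \<le> X t \<omega>)"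

text \<open>\<open>psi \<tau> l\<close> is the Laplace exponent at time \<open>\<tau>\<close>. The integrability requirement only
  excludes the default value of the integral; it is automatic when \<open>psi\<close> is continuous in \<open>\<tau>\<close>.\<close>

definition has_laplace_exponent ::
    "'a measure \<Rightarrow> (real \<Rightarrow> 'a \<Rightarrow> real) \<Rightarrow> (real \<Rightarrow> real \<Rightarrow> real) \<Rightarrow> bool" where
  "has_laplace_exponent M X psi \<longleftrightarrow>
     (\<forall>l>0. \<forall>s\<ge>0. \<forall>t\<ge>s.
        set_integrable lborel {s..t} (\<lambda>\<tau>. psi \<tau> l) \<and>
        (\<integral>\<omega>. exp (- l * (X t \<omega> - X s \<omega>)) \<partial>M) = exp (- (LBINT \<tau>:{s..t}. psi \<tau> l)))"

definition geometric_stable_exponent :: "real \<Rightarrow> (real \<Rightarrow> real) \<Rightarrow> real \<Rightarrow> real \<Rightarrow> real" where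
  "geometric_stable_exponent b \<alpha> \<tau> l = ln (1 + b * l powr \<alpha> \<tau>)"

definition inhom_geometric_stable_subordinator ::
    "'a measure \<Rightarrow> real \<Rightarrow> (real \<Rightarrow> real) \<Rightarrow> (real \<Rightarrow> 'a \<Rightarrow> real) \<Rightarrow> bool" where
  "inhom_geometric_stable_subordinator M b \<alpha> G \<longleftrightarrow>
     additive_process M G \<and> nondecreasing_paths M G \<and>
     has_laplace_exponent M G (geometric_stable_exponent b \<alpha>)"

text \<open>The finiteness condition makes \<open>1 - exp (- l * x)\<close> integrable for every \<open>l > 0\<close>,
  so the Bochner integral below is never a default value.\<close>

definition levy_measure_of_exponent :: "(real \<Rightarrow> real) \<Rightarrow> real measure \<Rightarrow> bool" where
  "levy_measure_of_exponent f N \<longleftrightarrow>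
     sets N = sets (restrict_space borel {0<..}) \<and>
     (\<integral>\<^sup>+x. ennreal (x / (1 + x)) \<partial>N) < \<infinity> \<and>
     (\<forall>l>0. f l = (\<integral>x. (1 - exp (- l * x)) \<partial>N))"

definition time_dependent_levy_measure ::
    "'a measure \<Rightarrow> (real \<Rightarrow> 'a \<Rightarrow> real) \<Rightarrow> (real \<Rightarrow> real \<Rightarrow> real) \<Rightarrow> (real \<Rightarrow> real measure) \<Rightarrow> bool" where
  "time_dependent_levy_measure M X psi \<nu> \<longleftrightarrow>
     has_laplace_exponent M X psi \<and>
     (\<forall>t\<ge>0. levy_measure_of_exponent (psi t) (\<nu> t))"

end

theory Submission imports Defs begin

text \<open>
  Write \<open>R x = E\<^sub>a (- c x\<^sup>a)\<close> with \<open>c = 1 / b\<close>. Termwise Beta integrals show that \<open>R\<close> solves the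
  fractional relaxation equation \<open>R x + c / \<Gamma> a * \<integral>\<^sub>0\<^sup>x (x - y)\<^sup>a\<^sup>-\<^sup>1 R y dy = 1\<close>.
  Comparing this equation at a first zero of \<open>R\<close> and slightly to its left shows that \<open>R\<close> is
  positive, which replaces the usual appeal to complete monotonicity. With positivity, Tonelli's theorem
  turns the equation into the Laplace transform \<open>s\<^sup>a\<^sup>-\<^sup>1 / (s\<^sup>a + c)\<close> for every \<open>s > 0\<close>,
  not only for those \<open>s\<close> for which the series can be transformed termwise; integrating in \<open>s\<close>
  from \<open>0\<close> to \<open>l\<close> yields \<open>ln (1 + l\<^sup>a / c)\<close>. For uniqueness, a Levy measure weighted by
  \<open>1 - exp (- x)\<close> and transported by \<open>x \<mapsto> exp (- x)\<close> is a finite measure on the unit interval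
  whose moments are differences of values of the exponent.
\<close>

section \<open>Growth of Gamma and convergence of the Mittag-Leffler series\<close>

text \<open>Restrict Euler's integral to \<open>{R..R+1}\<close>: there the power is at least
  \<open>R powr z\<close> and the exponential factor at least \<open>exp (- (R + 1))\<close>. As
  \<open>R\<close> is arbitrary, Gamma outgrows every exponential.\<close>

lemma Gamma_plus1_lower_bound:
  fixes R z :: real
  assumes "R > 0" "z \<ge> 0"
  shows "R powr z * exp (- (R + 1)) \<le> Gamma (z + 1)"
proof -
  have "ennreal (R powr z * exp (- (R + 1))) =
      (\<integral>\<^sup>+t. ennreal (R powr z * exp (- (R + 1))) * indicator {R..R+1} t \<partial>lborel)"
    by (subst nn_integral_cmult_indicator) auto
  also have "\<dots> \<le> (\<integral>\<^sup>+t. ennreal (indicator {0..} t * t powr (z + 1 - 1) / exp t) \<partial>lborel)"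
    using assms
    by (intro nn_integral_mono)
      (auto simp: indicator_def divide_inverse exp_minus[symmetric] intro!: ennreal_leI mult_mono powr_mono2)
  also have "\<dots> = ennreal (Gamma (z + 1))"
    using assms by (subst Gamma_conv_nn_integral_real) auto
  finally show ?thesis
    using assms by (subst (asm) ennreal_le_iff) (auto intro!: Gamma_real_nonneg)
qed

lemma Gamma_mult_plus1_pos: "a > 0 \<Longrightarrow> 0 < Gamma (a * real j + 1 :: real)"
  by (intro Gamma_real_pos add_nonneg_pos) auto

text \<open>Choosing \<open>R\<close> with \<open>R powr a = r\<close> turns the Gamma bound into a
  multiple of \<open>r ^ j\<close>. The choice \<open>r = 2 * \<bar>x\<bar> + 1\<close> is positive
  even for \<open>x = 0\<close> and leaves a geometric majorant of ratio below 1/2.\<close>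

lemma summable_mittag_leffler:
  fixes a x :: real
  assumes "a > 0"
  shows "summable (\<lambda>j. x ^ j / Gamma (a * real j + 1))"
proof -
  define r where "r = 2 * \<bar>x\<bar> + 1"
  define R where "R = r powr (1 / a)"
  have r: "r > 0" and R: "R > 0" by (auto simp: r_def R_def)
  have Rj: "R powr (a * real j) = r ^ j" for j
    using r assms by (simp add: R_def powr_powr powr_realpow)
  show ?thesis
  proof (rule summable_comparison_test')
    show "summable (\<lambda>j. exp (R + 1) * (\<bar>x\<bar> / r) ^ j)"
      by (intro summable_mult summable_geometric) (use r in \<open>auto simp: r_def\<close>)
    show "norm (x ^ j / Gamma (a * real j + 1)) \<le> exp (R + 1) * (\<bar>x\<bar> / r) ^ j" for j
    proof -
      have "r ^ j * exp (- (R + 1)) \<le> Gamma (a * real j + 1)"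
        using Gamma_plus1_lower_bound[OF R, of "a * real j"] assms by (simp add: Rj)
      hence "\<bar>x\<bar> ^ j / Gamma (a * real j + 1) \<le> \<bar>x\<bar> ^ j / (r ^ j * exp (- (R + 1)))"
        using r assms by (intro divide_left_mono mult_pos_pos Gamma_mult_plus1_pos) auto
      also have "\<dots> = exp (R + 1) * (\<bar>x\<bar> / r) ^ j"
        unfolding exp_minus by (simp add: power_mult_distrib power_inverse divide_inverse mult_ac)
      finally show ?thesis
        using Gamma_mult_plus1_pos[OF assms, of j] by (simp add: power_abs)
    qed
  qed
qed

lemma ex_has_field_derivative_mittag_leffler:
  assumes "a > 0"
  shows "\<exists>D. (mittag_leffler a has_field_derivative D) (at x)"
  using termdiffs_strong_converges_everywhere[of "\<lambda>j. inverse (Gamma (a * real j + 1))" x]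
    summable_mittag_leffler[OF assms]
  by (auto simp: mittag_leffler_def[abs_def] field_simps)

lemma continuous_mittag_leffler: "a > 0 \<Longrightarrow> continuous_on UNIV (mittag_leffler a)"
  using ex_has_field_derivative_mittag_leffler DERIV_isCont
  by (metis continuous_at_imp_continuous_on)

lemma mittag_leffler_0 [simp]: "mittag_leffler a 0 = 1"
  unfolding mittag_leffler_def
  by (subst suminf_finite[of "{0}"]) (auto simp: power_0_left)

section \<open>The relaxation function: regularity and series\<close>

definition relaxation :: "real \<Rightarrow> real \<Rightarrow> real \<Rightarrow> real" where
  "relaxation a c x = mittag_leffler a (- (c * x powr a))"

lemma borel_measurable_relaxation [measurable]:
  assumes "a > 0"
  shows "relaxation a c \<in> borel_measurable borel"
proof -
  have [measurable]: "mittag_leffler a \<in> borel_measurable borel"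
    using continuous_mittag_leffler[OF assms] by (rule borel_measurable_continuous_onI)
  show ?thesis unfolding relaxation_def[abs_def] by measurable
qed

lemma continuous_on_relaxation:
  assumes "a > 0"
  shows "continuous_on {0..} (relaxation a c)"
proof -
  have "continuous_on {0..} (\<lambda>x::real. - (c * x powr a))"
    using assms by (intro continuous_intros continuous_on_powr') auto
  thus ?thesis unfolding relaxation_def[abs_def]
    by (intro continuous_on_compose2[OF continuous_mittag_leffler[OF assms]]) auto
qed

lemma relaxation_0 [simp]: "relaxation a c 0 = 1"
  by (simp add: relaxation_def)

text \<open>Serves to bound the function linearly to the left of a hypothetical first nonpositive
  point. The origin is excluded because \<open>x powr a\<close> has no finite derivative there when
  \<open>a < 1\<close>.\<close>

lemma ex_has_field_derivative_relaxation:
  assumes "a > 0" "x > 0"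
  shows "\<exists>D. (relaxation a c has_field_derivative D) (at x)"
proof -
  obtain D where D: "(mittag_leffler a has_field_derivative D) (at (- (c * x powr a)))"
    using ex_has_field_derivative_mittag_leffler[OF assms(1)] by blast
  have "((\<lambda>x. - (c * x powr a)) has_field_derivative - (c * (a * x powr (a - 1)))) (at x)"
    using assms by (auto intro!: derivative_eq_intros)
  from DERIV_chain2[OF D this] show ?thesis
    unfolding relaxation_def[abs_def] by blast
qed

text \<open>The condition \<open>y > 0\<close> matters for the term \<open>j = 0\<close>: since
  \<open>0 powr 0 = 0\<close>, the series would lose its leading 1 at the origin.\<close>

lemma relaxation_sums:
  assumes "a > 0" "y > 0"
  shows "(\<lambda>j. (- c) ^ j * y powr (a * real j) / Gamma (a * real j + 1)) sums relaxation a c y"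
proof -
  have "(- (c * y powr a)) ^ j = (- c) ^ j * y powr (a * real j)" for j
    using assms by (simp add: powr_power mult.commute[of a] power_mult_distrib power_minus[of c] power_minus[of "c * y powr a"])
  thus ?thesis
    using summable_sums[OF summable_mittag_leffler[OF assms(1), of "- (c * y powr a)"]]
    by (simp add: relaxation_def mittag_leffler_def)
qed

section \<open>The Volterra equation\<close>

text \<open>The substitution \<open>y = x * t\<close> reduces to the Beta integral over the unit
  interval; the two powers contribute \<open>x powr (a + p - 2)\<close> and \<open>dy\<close> one
  more factor \<open>x\<close>.\<close>

lemma has_bochner_integral_Beta_interval:
  fixes a p x :: real
  assumes "a > 0" "p > 0" "x > 0"
  shows "has_bochner_integral lborel
    (\<lambda>y. indicator {0<..<x} y * ((x - y) powr (a - 1) * y powr (p - 1))) (x powr (a + p - 1) * Beta a p)"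
proof (rule has_bochner_integral_nn_integral)
  have B: "0 \<le> Beta a p"
    using assms by (auto simp: Beta_def intro!: divide_nonneg_nonneg mult_nonneg_nonneg Gamma_real_nonneg)
  show "0 \<le> x powr (a + p - 1) * Beta a p" using B by simp
  have "((\<lambda>t. (1 - t) powr (a - 1) * t powr (p - 1)) has_integral Beta a p) {0..1}"
    using has_integral_Beta_real[of p a] assms by (simp add: Beta_commute mult.commute)
  note nn_integral_has_integral_lebesgue[OF _ this]
  hence 1: "(\<integral>\<^sup>+t. ennreal (indicator {0..1} t * ((1 - t) powr (a - 1) * t powr (p - 1))) \<partial>lborel) = ennreal (Beta a p)"
    by simp
  have "(\<integral>\<^sup>+y. ennreal (indicator {0<..<x} y * ((x - y) powr (a - 1) * y powr (p - 1))) \<partial>lborel)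
     = ennreal \<bar>x\<bar> * (\<integral>\<^sup>+t. ennreal (indicator {0<..<x} (0 + x * t) * ((x - (0 + x * t)) powr (a - 1) * (0 + x * t) powr (p - 1))) \<partial>lborel)"
    using assms by (intro nn_integral_real_affine) auto
  also have "\<dots> = ennreal x * (\<integral>\<^sup>+t. ennreal (x powr (a + p - 2)) *
      ennreal (indicator {0..1} t * ((1 - t) powr (a - 1) * t powr (p - 1))) \<partial>lborel)"
  proof -
    have "indicator {0<..<x} (0 + x * t) * ((x - (0 + x * t)) powr (a - 1) * (0 + x * t) powr (p - 1))
      = x powr (a + p - 2) * (indicator {0..1} t * ((1 - t) powr (a - 1) * t powr (p - 1)))" for t
    proof (cases "0 < t \<and> t < 1")
      case True
      have "x - x * t = x * (1 - t)" by (simp add: algebra_simps)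
      moreover have "x powr (a + p - 2) = x powr (a - 1) * x powr (p - 1)"
        by (simp flip: powr_add)
      ultimately show ?thesis using True assms by (simp add: powr_mult)
    next
      \<comment> \<open>At \<open>t = 0\<close> and \<open>t = 1\<close> one of the powers has base
        0 and hence value 0, so the open and the closed indicator give the same function.\<close>
      case False
      thus ?thesis using assms
        by (cases "t = 0 \<or> t = 1") (auto simp: indicator_def zero_less_mult_iff)
    qed
    thus ?thesis using assms by (simp add: ennreal_mult')
  qed
  also have "\<dots> = ennreal (x * (x powr (a + p - 2) * Beta a p))"
    using assms B by (subst nn_integral_cmult) (measurable, simp only: 1, simp add: ennreal_mult)
  also have "x * (x powr (a + p - 2) * Beta a p) = x powr (a + p - 1) * Beta a p"
    using assms powr_add[of x 1 "a + p - 2"] by simp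
  finally show "(\<integral>\<^sup>+y. ennreal (indicator {0<..<x} y * ((x - y) powr (a - 1) * y powr (p - 1))) \<partial>lborel)
     = ennreal (x powr (a + p - 1) * Beta a p)" .
  show "(\<lambda>y. indicator {0<..<x} y * ((x - y) powr (a - 1) * y powr (p - 1))) \<in> borel_measurable lborel"
    by measurable
  show "AE y in lborel. 0 \<le> indicator {0<..<x} y * ((x - y) powr (a - 1) * y powr (p - 1))"
    by (intro AE_I2 mult_nonneg_nonneg) simp_all
qed

text \<open>Integrate the series of \<open>R\<close> against the kernel term by term:
  \<open>f j\<close> is the j-th term and \<open>I j\<close> its integral. The Beta value cancels
  \<open>Gamma (a * real j + 1)\<close> and produces the next denominator, so the integral operator
  shifts the series by one index.\<close>

lemma relaxation_volterra:
  assumes "a > 0" "c > 0" "x > 0"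
  shows "integrable lborel (\<lambda>y. indicator {0<..<x} y * ((x - y) powr (a - 1) * relaxation a c y))"
      (is "integrable _ ?g")
    and "relaxation a c x + c / Gamma a *
      (\<integral>y. indicator {0<..<x} y * ((x - y) powr (a - 1) * relaxation a c y) \<partial>lborel) = 1"
proof -
  define f where "f j y = (- c) ^ j / Gamma (a * real j + 1) *
     (indicator {0<..<x} y * ((x - y) powr (a - 1) * y powr ((a * real j + 1) - 1)))" for j y
  define I where "I j = (- c) ^ j * (Gamma a * x powr (a * real (Suc j)) / Gamma (a * real (Suc j) + 1))" for j
  have Gp: "Gamma (a * real j + 1) > 0" for j by (rule Gamma_mult_plus1_pos[OF assms(1)])
  have Gnz: "Gamma (a * real j + 1) \<noteq> 0" for j using Gp[of j] by linarith
  have Ga: "Gamma a > 0" using assms by (intro Gamma_real_pos)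
  have bf: "has_bochner_integral lborel (f j) (I j)" for j
  proof -
    have "has_bochner_integral lborel (f j) ((- c) ^ j / Gamma (a * real j + 1) *
        (x powr (a + (a * real j + 1) - 1) * Beta a (a * real j + 1)))"
      unfolding f_def
      by (intro has_bochner_integral_mult_right has_bochner_integral_Beta_interval)
        (use assms in \<open>auto intro!: add_nonneg_pos\<close>)
    also have "(- c) ^ j / Gamma (a * real j + 1) *
        (x powr (a + (a * real j + 1) - 1) * Beta a (a * real j + 1)) = I j"
      using Gnz[of j] by (simp add: I_def Beta_def algebra_simps)
    finally show ?thesis .
  qed
  \<comment> \<open>Each \<open>f j\<close> has the constant sign \<open>(- 1) ^ j\<close>, so its
    norm integrates to \<open>\<bar>I j\<bar>\<close>. Up to the factor \<open>Gamma a / c\<close>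
    these values form the Mittag-Leffler series at \<open>c * x powr a\<close> without its first
    term, hence are summable.\<close>
  have norm_f: "norm (f j y) = (- 1) ^ j * f j y" for j y
  proof -
    have "f j y = (- 1) ^ j * (c ^ j / Gamma (a * real j + 1) *
        (indicator {0<..<x} y * ((x - y) powr (a - 1) * y powr ((a * real j + 1) - 1))))"
      by (simp add: f_def power_minus[of c j])
    moreover have "0 \<le> c ^ j / Gamma (a * real j + 1) *
        (indicator {0<..<x} y * ((x - y) powr (a - 1) * y powr ((a * real j + 1) - 1)))"
      using Gp[of j] assms by simp
    moreover have "norm ((- 1) ^ j * u) = (- 1) ^ j * ((- 1) ^ j * u)" if "0 \<le> u" for u :: real
      using that by (simp add: abs_mult flip: mult.assoc power_mult_distrib)
    ultimately show ?thesis by metis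
  qed
  have summ: "summable (\<lambda>j. \<bar>I j\<bar>)"
  proof -
    have "summable (\<lambda>j. (c * x powr a) ^ Suc j / Gamma (a * real (Suc j) + 1))"
      using summable_mittag_leffler[OF assms(1), of "c * x powr a"] by (subst summable_Suc_iff)
    hence "summable (\<lambda>j. Gamma a / c * ((c * x powr a) ^ Suc j / Gamma (a * real (Suc j) + 1)))"
      by (rule summable_mult)
    also have "(\<lambda>j. Gamma a / c * ((c * x powr a) ^ Suc j / Gamma (a * real (Suc j) + 1)))
      = (\<lambda>j. \<bar>I j\<bar>)"
    proof
      fix j
      have xp: "(x powr a) ^ Suc j = x powr (a * real (Suc j))"
        using assms by (subst powr_power) (auto simp: mult.commute)
      show "Gamma a / c * ((c * x powr a) ^ Suc j / Gamma (a * real (Suc j) + 1)) = \<bar>I j\<bar>"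
        using assms Ga Gp[of "Suc j"] unfolding I_def power_mult_distrib abs_mult abs_divide xp
        by (simp add: power_abs)
    qed
    finally show ?thesis .
  qed
  have *: "integrable lborel (f j)" for j using bf[of j] by (simp add: has_bochner_integral_iff)
  have **: "AE y in lborel. summable (\<lambda>j. norm (f j y))"
  proof (rule AE_I2)
    fix y
    show "summable (\<lambda>j. norm (f j y))"
    proof (cases "0 < y \<and> y < x")
      case True
      have "summable (\<lambda>j. (x - y) powr (a - 1) * ((c * y powr a) ^ j / Gamma (a * real j + 1)))"
        using summable_mittag_leffler[OF assms(1)] by (rule summable_mult)
      also have "(\<lambda>j. (x - y) powr (a - 1) * ((c * y powr a) ^ j / Gamma (a * real j + 1)))
        = (\<lambda>j. norm (f j y))"
      proof
        fix j
        have "(y powr a) ^ j = y powr (a * real j)"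
          using True by (subst powr_power) (auto simp: mult.commute)
        thus "(x - y) powr (a - 1) * ((c * y powr a) ^ j / Gamma (a * real j + 1)) = norm (f j y)"
          using True Gp[of j] assms by (simp add: f_def abs_mult power_abs power_mult_distrib)
      qed
      finally show ?thesis .
    qed (auto simp: f_def)
  qed
  have ***: "summable (\<lambda>j. \<integral>y. norm (f j y) \<partial>lborel)"
  proof -
    have "norm (\<integral>y. norm (f j y) \<partial>lborel) \<le> \<bar>I j\<bar>" for j
    proof -
      have "(\<integral>y. norm (f j y) \<partial>lborel) = (- 1) ^ j * I j"
        using bf[of j] by (simp add: norm_f has_bochner_integral_integral_eq del: real_norm_def)
      thus ?thesis by (auto simp: abs_mult power_abs)
    qed
    thus ?thesis by (rule summable_comparison_test'[OF summ])
  qed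
  have fg: "(\<Sum>j. f j y) = ?g y" for y
  proof (cases "0 < y \<and> y < x")
    case True
    hence "(\<lambda>j. (x - y) powr (a - 1) * ((- c) ^ j * y powr (a * real j) / Gamma (a * real j + 1))) sums
        ((x - y) powr (a - 1) * relaxation a c y)"
      by (intro sums_mult relaxation_sums assms) auto
    thus ?thesis using True by (simp add: f_def sums_iff field_simps)
  qed (auto simp: f_def)
  show "integrable lborel ?g"
    using integrable_suminf[OF * ** ***] by (simp only: fg)
  have "integral\<^sup>L lborel (f j) = I j" for j
    using bf[of j] by (rule has_bochner_integral_integral_eq)
  hence "I sums integral\<^sup>L lborel ?g"
    using sums_integral[OF * ** ***] by (simp only: fg)
  hence 1: "(\<lambda>j. c / Gamma a * I j) sums (c / Gamma a * integral\<^sup>L lborel ?g)"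
    by (rule sums_mult)
  \<comment> \<open>The terms are those of \<open>R\<close> from index 1 on with the sign reversed;
    the missing term of index 0 equals 1.\<close>
  have 2: "(\<lambda>j. c / Gamma a * I j) sums (1 - relaxation a c x)"
  proof -
    have "(\<lambda>j. (- c) ^ Suc j * x powr (a * real (Suc j)) / Gamma (a * real (Suc j) + 1)) sums (relaxation a c x - 1)"
      using relaxation_sums[OF assms(1,3), of c] assms by (subst sums_Suc_iff) auto
    from sums_minus[OF this] show ?thesis using Ga by (simp add: I_def mult.assoc)
  qed
  show "relaxation a c x + c / Gamma a * integral\<^sup>L lborel ?g = 1"
    using sums_unique2[OF 1 2] by simp
qed

section \<open>Positivity of the relaxation function\<close>

text \<open>At the first point \<open>z\<close> with \<open>R z \<le> 0\<close> the equation forces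
  \<open>C * I z \<ge> 1\<close>, whereas \<open>C * I w < 1\<close> for \<open>w\<close> slightly
  smaller. But moving from \<open>w\<close> to \<open>z\<close> weakens the kernel, because
  \<open>a < 1\<close>, by an amount of first order in the step, and the newly covered piece is of
  higher order, so such growth is impossible.\<close>

lemma relaxation_pos:
  assumes a: "0 < a" "a < 1" and c: "c > 0" and x: "x \<ge> 0"
  shows "relaxation a c x > 0"
proof (rule ccontr)
  assume neg: "\<not> relaxation a c x > 0"
  define R where "R = relaxation a c"
  define C where "C = c / Gamma a"
  have C: "C > 0" using a c by (auto simp: C_def intro!: divide_pos_pos Gamma_real_pos)
  define S where "S = {y \<in> {0..x}. R y \<le> 0}"
  have cont: "continuous_on {0..x} R"
    unfolding R_def using a by (intro continuous_on_subset[OF continuous_on_relaxation]) auto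
  have "closed S"
    unfolding S_def by (intro continuous_on_closed_Collect_le cont) auto
  moreover have S_sub: "S \<subseteq> {0..x}" by (auto simp: S_def)
  ultimately have "compact S"
    using compact_Int_closed[OF compact_Icc[of 0 x]] by (metis S_sub inf.absorb2)
  moreover have "S \<noteq> {}" using neg x by (auto simp: S_def R_def)
  ultimately have "\<exists>z\<in>S. \<forall>y\<in>S. z \<le> y" by (rule compact_attains_inf)
  then obtain z where z: "z \<in> S" "\<And>y. y \<in> S \<Longrightarrow> z \<le> y"
    by blast
  have "z \<noteq> 0" using z(1) by (auto simp: S_def R_def)
  hence z0: "z > 0" and Rz: "R z \<le> 0" using z(1) by (auto simp: S_def)
  have pos: "R y > 0" if "0 \<le> y" "y < z" for y
    using z(2)[of y] z(1) that by (force simp: S_def)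
  obtain D where "(R has_field_derivative D) (at z)"
    using ex_has_field_derivative_relaxation[OF a(1) z0] unfolding R_def by blast
  hence "(\<lambda>y. (R y - R z) / (y - z)) \<midarrow>z\<rightarrow> D"
    by (simp add: has_field_derivative_iff)
  from LIM_D[OF this, of 1] obtain d where d: "d > 0"
    "\<And>y. y \<noteq> z \<Longrightarrow> \<bar>y - z\<bar> < d \<Longrightarrow> \<bar>(R y - R z) / (y - z) - D\<bar> < 1"
    by auto
  \<comment> \<open>Differentiability at \<open>z\<close> together with \<open>R z \<le> 0\<close>
    gives \<open>R y \<le> K * (z - y)\<close> just to the left of \<open>z\<close>.\<close>
  define K where "K = \<bar>D\<bar> + 1"
  have K: "K > 0" by (auto simp: K_def)
  have RK: "R y \<le> K * (z - y)" if "z - d < y" "y < z" for y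
  proof -
    have "\<bar>(R y - R z) / (y - z) - D\<bar> < 1"
      using that by (intro d(2)) auto
    hence "\<bar>(R y - R z) / (y - z)\<bar> \<le> K"
      unfolding K_def by linarith
    hence "\<bar>R y - R z\<bar> \<le> K * (z - y)"
      using that by (simp add: abs_divide field_simps)
    thus ?thesis using Rz by linarith
  qed
  txt \<open>By log-convexity of the kernel the integral over \<open>(0, z - \<delta>)\<close> drops by a factor
    \<open>\<theta> = 1 - O(\<delta>)\<close> from \<open>z - \<delta>\<close> to \<open>z\<close>, while the remaining piece, where \<open>R\<close> is \<open>O(\<delta>)\<close>,
    contributes only \<open>O(\<delta>\<^sup>1\<^sup>+\<^sup>a)\<close>.\<close>
  have key: "(1 - a) / (2 * z) \<le> C * K * \<delta> powr a" if \<delta>: "0 < \<delta>" "\<delta> < d" "\<delta> < z" for \<delta>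
  proof -
    define w where "w = z - \<delta>"
    define \<theta> where "\<theta> = (w / z) powr (1 - a)"
    define v where "v = (1 - a) * (\<delta> / z)"
    have w: "0 < w" "w < z" using \<delta> by (auto simp: w_def)
    define I where "I u = (\<integral>y. indicator {0<..<u} y * ((u - y) powr (a - 1) * R y) \<partial>lborel)" for u
    have Iint: "integrable lborel (\<lambda>y. indicator {0<..<u} y * ((u - y) powr (a - 1) * R y))"
      and Ieq: "R u + C * I u = 1" if "u > 0" for u
      using relaxation_volterra[OF a(1) c that] by (simp_all add: I_def R_def C_def)
    have "I z \<le> (\<integral>y. \<theta> * (indicator {0<..<w} y * ((w - y) powr (a - 1) * R y)) + K * \<delta> powr a * indicator {w..z} y \<partial>lborel)"
      unfolding I_def
    proof (intro integral_mono Bochner_Integration.integrable_add integrable_mult_right Iint z0 w)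
      fix y
      show "indicator {0<..<z} y * ((z - y) powr (a - 1) * R y) \<le>
        \<theta> * (indicator {0<..<w} y * ((w - y) powr (a - 1) * R y)) + K * \<delta> powr a * indicator {w..z} y"
      proof (cases "0 < y \<and> y < z")
        case y: True
        show ?thesis
        proof (cases "y < w")
          case True
          \<comment> \<open>For \<open>w < z\<close> this ratio decreases in \<open>y\<close>; its
            value at \<open>y = 0\<close> is the source of \<open>\<theta>\<close>.\<close>
          have "(w - y) / (z - y) \<le> w / z"
            using y w z0 by (simp add: field_simps)
          hence "((w - y) / (z - y)) powr (1 - a) \<le> \<theta>"
            unfolding \<theta>_def using True y a by (intro powr_mono2) auto
          moreover have "((w - y) / (z - y)) powr (1 - a) = (z - y) powr (a - 1) / (w - y) powr (a - 1)"
            using True y by (simp add: powr_divide powr_diff field_simps)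
          ultimately have "(z - y) powr (a - 1) \<le> \<theta> * (w - y) powr (a - 1)"
            using True by (simp add: field_simps)
          hence "(z - y) powr (a - 1) * R y \<le> \<theta> * (w - y) powr (a - 1) * R y"
            using pos[of y] y by (intro mult_right_mono) auto
          thus ?thesis using True y by (simp add: mult_ac)
        next
          case False
          \<comment> \<open>The linear bound on \<open>R\<close> absorbs the singularity of the
            kernel and leaves a power with positive exponent.\<close>
          have "(z - y) powr (a - 1) * R y \<le> (z - y) powr (a - 1) * (K * (z - y))"
            using RK[of y] False y \<delta> by (intro mult_left_mono) (auto simp: w_def)
          also have "\<dots> = K * (z - y) powr a"
            using y by (simp add: powr_diff)
          also have "\<dots> \<le> K * \<delta> powr a"
            using K False y a by (intro mult_left_mono powr_mono2) (auto simp: w_def)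
          finally show ?thesis using y False by simp
        qed
      next
        case False
        hence "\<not> (0 < y \<and> y < w)" using w by auto
        thus ?thesis using False K by simp
      qed
    qed (auto intro!: integrable_real_indicator simp: emeasure_lborel_Icc_eq)
    also have "\<dots> = \<theta> * I w + K * \<delta> powr a * \<delta>"
      using Iint[OF w(1)] w by (subst Bochner_Integration.integral_add) (auto simp: I_def w_def)
    finally have "C * I z \<le> C * (\<theta> * I w + K * \<delta> powr a * \<delta>)"
      using C by (intro mult_left_mono) auto
    \<comment> \<open>The equation at \<open>z\<close> with \<open>R z \<le> 0\<close> bounds the
      left side below by 1; at \<open>w\<close>, where \<open>R\<close> is positive, it bounds
      \<open>C * I w\<close> above by 1.\<close>
    hence "1 \<le> \<theta> * (C * I w) + C * K * \<delta> powr a * \<delta>"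
      using Ieq[OF z0] Rz by (simp add: algebra_simps)
    also have "\<theta> * (C * I w) \<le> \<theta> * 1"
      using Ieq[OF w(1)] pos[of w] w by (intro mult_left_mono) (auto simp: \<theta>_def)
    finally have 1: "1 \<le> \<theta> + C * K * \<delta> powr a * \<delta>" by simp
    have v: "0 \<le> v" "v \<le> 1"
      using a \<delta> z0 mult_mono[of "1 - a" 1 "\<delta> / z" 1] by (simp_all add: v_def)
    \<comment> \<open>From \<open>w / z = 1 - \<delta> / z\<close> follows
      \<open>\<theta> \<le> exp (- v)\<close>, and \<open>0 \<le> v \<le> 1\<close> then yields the
      linear bound \<open>1 - v / 2\<close>.\<close>
    have "ln (w / z) \<le> - (\<delta> / z)"
      using ln_le_minus_one[of "w / z"] w z0 by (simp add: w_def diff_divide_distrib)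
    hence "(1 - a) * ln (w / z) \<le> - v"
      using a mult_left_mono[of "ln (w / z)" "- (\<delta> / z)" "1 - a"] by (simp add: v_def)
    hence "\<theta> \<le> exp (- v)" using w z0 by (simp add: \<theta>_def powr_def)
    also have "\<dots> \<le> inverse (1 + v)"
      using v exp_ge_add_one_self[of v] by (simp add: exp_minus le_imp_inverse_le)
    also have "\<dots> \<le> 1 - v / 2"
    proof -
      have "1 \<le> (1 - v / 2) * (1 + v)"
        using v mult_left_mono[of v 1 v] by (simp add: algebra_simps)
      thus ?thesis using v by (simp add: field_simps)
    qed
    finally have "v / 2 \<le> C * K * \<delta> powr a * \<delta>" using 1 by linarith
    hence "(1 - a) / (2 * z) * \<delta> \<le> C * K * \<delta> powr a * \<delta>"
      by (simp add: v_def mult.commute)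
    thus ?thesis using \<delta> by (simp only: mult_le_cancel_right_pos)
  qed
  \<comment> \<open>In \<open>key\<close> one factor \<open>\<delta>\<close> has been cancelled: a
    fixed positive number stays below a multiple of \<open>\<delta> powr a\<close>, which tends to
    0.\<close>
  have "((\<lambda>\<delta>. C * K * \<delta> powr a) \<longlongrightarrow> C * K * 0) (at_right 0)"
    by (intro tendsto_mult tendsto_const tendsto_powr'[THEN tendsto_eq_rhs] tendsto_ident_at)
      (use a in \<open>auto intro: eventually_mono[OF eventually_at_right_less]\<close>)
  hence "\<forall>\<^sub>F \<delta> in at_right 0. C * K * \<delta> powr a < (1 - a) / (2 * z)"
    by (rule order_tendstoD) (use a z0 in auto)
  moreover have "\<forall>\<^sub>F \<delta> in at_right 0. \<delta> \<in> {0<..<min d z}"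
    using d(1) z0 by (intro eventually_at_right_real) auto
  ultimately have "\<forall>\<^sub>F \<delta> in at_right (0::real). False"
  proof eventually_elim
    case (elim \<delta>)
    with key[of \<delta>] show False by auto
  qed
  thus False by (simp add: trivial_limit_at_right_real flip: trivial_limit_def)
qed

section \<open>The Laplace transform\<close>

text \<open>Euler's integral after the substitution \<open>t = s * x\<close>. It transforms both the
  kernel and, with exponent 1 in place of \<open>a\<close>, the constant right side of the Volterra
  equation.\<close>

lemma nn_integral_powr_exp:
  fixes a s :: real
  assumes "a > 0" "s > 0"
  shows "(\<integral>\<^sup>+x. ennreal (indicator {0<..} x * (exp (- s * x) * x powr (a - 1))) \<partial>lborel)
    = ennreal (Gamma a / s powr a)"
proof -
  have G: "Gamma a > 0" using assms by (intro Gamma_real_pos)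
  have "ennreal (Gamma a) = (\<integral>\<^sup>+t. ennreal (indicator {0..} t * t powr (a - 1) / exp t) \<partial>lborel)"
    using assms by (intro Gamma_conv_nn_integral_real)
  also have "\<dots> = ennreal \<bar>s\<bar> *
      (\<integral>\<^sup>+x. ennreal (indicator {0..} (0 + s * x) * (0 + s * x) powr (a - 1) / exp (0 + s * x)) \<partial>lborel)"
    using assms by (intro nn_integral_real_affine) auto
  also have "\<dots> = ennreal s * (\<integral>\<^sup>+x. ennreal (s powr (a - 1)) *
      ennreal (indicator {0<..} x * (exp (- s * x) * x powr (a - 1))) \<partial>lborel)"
  proof -
    have "indicator {0..} (0 + s * x) * (0 + s * x) powr (a - 1) / exp (0 + s * x) =
       s powr (a - 1) * (indicator {0<..} x * (exp (- s * x) * x powr (a - 1)))" for x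
      using assms by (cases "x = 0")
        (auto simp: indicator_def zero_le_mult_iff powr_mult exp_minus field_simps)
    thus ?thesis using assms by (simp add: ennreal_mult')
  qed
  also have "\<dots> = ennreal (s powr a) *
      (\<integral>\<^sup>+x. ennreal (indicator {0<..} x * (exp (- s * x) * x powr (a - 1))) \<partial>lborel)"
    using assms by (subst nn_integral_cmult)
      (measurable, simp add: powr_diff flip: mult.assoc ennreal_mult)
  finally have *: "ennreal (Gamma a) = ennreal (s powr a) *
      (\<integral>\<^sup>+x. ennreal (indicator {0<..} x * (exp (- s * x) * x powr (a - 1))) \<partial>lborel)" .
  \<comment> \<open>The integral is not yet known to be finite, so \<open>s powr a\<close> is
    removed by multiplying with its inverse in the extended reals.\<close>
  have "ennreal (1 / s powr a) * ennreal (Gamma a) = 1 *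
      (\<integral>\<^sup>+x. ennreal (indicator {0<..} x * (exp (- s * x) * x powr (a - 1))) \<partial>lborel)"
    unfolding * mult.assoc[symmetric] using assms by (simp flip: ennreal_mult)
  thus ?thesis using assms G by (simp flip: ennreal_mult)
qed

text \<open>Multiply the Volterra equation by \<open>exp (- s * x)\<close> and integrate. By
  positivity Tonelli applies for every \<open>s > 0\<close> and the convolution becomes a product:
  \<open>L + C * L * Gamma a / s powr a = 1 / s\<close>, which is solved for
  \<open>L\<close>.\<close>

lemma laplace_relaxation:
  assumes a: "0 < a" "a < 1" and c: "c > 0" and s: "s > 0"
  shows "(\<integral>\<^sup>+x. ennreal (indicator {0<..} x * (exp (- s * x) * relaxation a c x)) \<partial>lborel)
    = ennreal (s powr (a - 1) / (s powr a + c))"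
proof -
  define R where "R = relaxation a c"
  define C where "C = c / Gamma a"
  have Ga: "Gamma a > 0" using a by (intro Gamma_real_pos)
  have C: "C > 0" using Ga c by (auto simp: C_def)
  have [measurable]: "R \<in> borel_measurable borel" unfolding R_def using a by measurable
  have R0: "0 < R x" if "0 \<le> x" for x unfolding R_def using relaxation_pos a c that by blast
  \<comment> \<open>Writing the support as \<open>y > 0\<close> and \<open>x - y > 0\<close> lets
    the translation by \<open>y\<close> in \<open>H2\<close> split the integrand into a factor in
    \<open>y\<close> and one in \<open>x\<close>.\<close>
  define H where "H x y = indicator {0<..} y * (indicator {0<..} (x - y) * (exp (- s * x) * ((x - y) powr (a - 1) * R y)))" for x y :: real
  define L where "L = (\<integral>\<^sup>+x. ennreal (indicator {0<..} x * (exp (- s * x) * R x)) \<partial>lborel)"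
  have [measurable]: "(\<lambda>(x, y). ennreal (H x y)) \<in> borel_measurable (lborel \<Otimes>\<^sub>M lborel)"
    unfolding H_def by measurable
  have H1: "ennreal (indicator {0<..} x * exp (- s * x)) = ennreal (indicator {0<..} x * (exp (- s * x) * R x))
      + ennreal C * (\<integral>\<^sup>+y. ennreal (H x y) \<partial>lborel)" for x
  proof (cases "x > 0")
    case True
    let ?g = "\<lambda>y. indicator {0<..<x} y * ((x - y) powr (a - 1) * R y)"
    have int: "integrable lborel ?g" and eq: "R x + C * integral\<^sup>L lborel ?g = 1"
      using relaxation_volterra[OF a(1) c True] by (simp_all add: R_def C_def)
    have g0: "0 \<le> ?g y" for y using R0[of y] by (auto simp: indicator_def)
    have "(\<integral>\<^sup>+y. ennreal (H x y) \<partial>lborel) = (\<integral>\<^sup>+y. ennreal (exp (- s * x)) * ennreal (?g y) \<partial>lborel)"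
      by (intro nn_integral_cong, subst ennreal_mult[symmetric]) (use g0 in \<open>auto simp: H_def indicator_def\<close>)
    also have "\<dots> = ennreal (exp (- s * x)) * ennreal (integral\<^sup>L lborel ?g)"
      using int g0 by (subst nn_integral_cmult) (auto simp: nn_integral_eq_integral simp del: mult_eq_0_iff)
    finally have "(\<integral>\<^sup>+y. ennreal (H x y) \<partial>lborel) =
      ennreal (exp (- s * x)) * ennreal (integral\<^sup>L lborel ?g)" .
    moreover have "0 \<le> integral\<^sup>L lborel ?g"
      using g0 by (rule Bochner_Integration.integral_nonneg)
    moreover have "exp (- s * x) = exp (- s * x) * R x + C * (exp (- s * x) * integral\<^sup>L lborel ?g)"
      using arg_cong[OF eq, of "\<lambda>u. exp (- s * x) * u"] by (simp only: distrib_left mult_1_right mult.left_commute)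
    ultimately show ?thesis
      using True C R0[of x] by (simp del: mult_minus_left flip: ennreal_mult ennreal_plus)
  next
    case False
    hence "H x y = 0" for y by (auto simp: H_def indicator_def)
    thus ?thesis using False by simp
  qed
  have H2: "(\<integral>\<^sup>+x. ennreal (H x y) \<partial>lborel) = ennreal (indicator {0<..} y * (exp (- s * y) * R y)) * ennreal (Gamma a / s powr a)" for y
  proof (cases "y > 0")
    case True
    have "(\<integral>\<^sup>+x. ennreal (H x y) \<partial>lborel) = ennreal \<bar>1\<bar> * (\<integral>\<^sup>+x. ennreal (H (y + 1 * x) y) \<partial>lborel)"
      by (intro nn_integral_real_affine) auto
    also have "\<dots> = (\<integral>\<^sup>+x. ennreal (exp (- s * y) * R y) * ennreal (indicator {0<..} x * (exp (- s * x) * x powr (a - 1))) \<partial>lborel)"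
    proof -
      have "exp (- s * (y + 1 * x)) = exp (- s * y) * exp (- s * x)" for x
        by (simp add: mult_exp_exp algebra_simps)
      thus ?thesis using True R0[of y]
        by (simp only: H_def) (simp add: mult_ac flip: ennreal_mult)
    qed
    also have "\<dots> = ennreal (exp (- s * y) * R y) * ennreal (Gamma a / s powr a)"
      by (subst nn_integral_cmult) (measurable, simp only: nn_integral_powr_exp[OF a(1) s])
    finally show ?thesis using True by simp
  qed (simp add: H_def)
  have "ennreal (1 / s) = (\<integral>\<^sup>+x. ennreal (indicator {0<..} x * exp (- s * x)) \<partial>lborel)"
  proof -
    have "(\<integral>\<^sup>+x. ennreal (indicator {0<..} x * (exp (- s * x) * x powr (1 - 1))) \<partial>lborel) =
       (\<integral>\<^sup>+x. ennreal (indicator {0<..} x * exp (- s * x)) \<partial>lborel)"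
      by (intro nn_integral_cong) (auto simp: indicator_def)
    thus ?thesis using nn_integral_powr_exp[of 1 s] s by simp
  qed
  also have "\<dots> = L + ennreal C * (\<integral>\<^sup>+x. \<integral>\<^sup>+y. ennreal (H x y) \<partial>lborel \<partial>lborel)"
    unfolding H1 L_def by (subst nn_integral_add, simp, simp, subst nn_integral_cmult) auto
  also have "(\<integral>\<^sup>+x. \<integral>\<^sup>+y. ennreal (H x y) \<partial>lborel \<partial>lborel) = (\<integral>\<^sup>+y. \<integral>\<^sup>+x. ennreal (H x y) \<partial>lborel \<partial>lborel)"
    by (rule lborel_pair.Fubini'[symmetric]) measurable
  also have "\<dots> = L * ennreal (Gamma a / s powr a)"
    unfolding H2 L_def by (subst nn_integral_multc) auto
  finally have eq: "ennreal (1 / s) = L + ennreal C * (L * ennreal (Gamma a / s powr a))" .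
  \<comment> \<open>\<open>L\<close> is a summand of the finite value \<open>1 / s\<close>, so the
    equation may be solved in the reals.\<close>
  have "L \<noteq> \<infinity>" using eq by (metis ennreal_neq_top ennreal_add_eq_top infinity_ennreal_def)
  then obtain r where r: "r \<ge> 0" "L = ennreal r" by (cases L) auto
  have "ennreal (1 / s) = ennreal (r + C * (r * (Gamma a / s powr a)))"
    using eq r C Ga by (simp del: times_divide_eq_right flip: ennreal_mult ennreal_plus)
  hence "1 / s = r + C * (r * (Gamma a / s powr a))"
    using s r C Ga by (subst (asm) ennreal_inj) auto
  hence "r = s powr (a - 1) / (s powr a + c)"
  proof -
    have "r * (s powr a + c) = s powr a / s"
      using \<open>1 / s = _\<close> s Ga by (simp add: C_def field_simps)
    moreover have "s powr a + c > 0" using c by (intro add_nonneg_pos) auto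
    ultimately show ?thesis using s by (simp add: powr_diff nonzero_eq_divide_eq mult_ac)
  qed
  thus ?thesis using r by (simp add: L_def R_def)
qed

section \<open>The logarithmic exponent\<close>

text \<open>Since \<open>(1 - exp (- l * x)) / x\<close> is the integral of
  \<open>exp (- u * x)\<close> over \<open>u\<close> in \<open>{0<..<l}\<close>, Tonelli reduces the
  claim to integrating \<open>a\<close> times the Laplace transform. This product is
  \<open>h\<close>, the derivative of \<open>ln (1 + u powr a / c)\<close>.\<close>

lemma nn_integral_levy_relaxation:
  assumes a: "0 < a" "a < 1" and c: "c > 0" and l: "l > 0"
  shows "(\<integral>\<^sup>+x. ennreal (indicator {0<..} x * ((1 - exp (- l * x)) * (a / x * relaxation a c x))) \<partial>lborel)
    = ennreal (ln (1 + l powr a / c))"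
proof -
  define R where "R = relaxation a c"
  have [measurable]: "R \<in> borel_measurable borel" unfolding R_def using a by measurable
  have R0: "0 < R x" if "0 \<le> x" for x unfolding R_def using relaxation_pos a c that by blast
  define H where "H u x = indicator {0<..<l} u * (indicator {0<..} x * (a * (exp (- u * x) * R x)))" for u x :: real
  have [measurable]: "(\<lambda>(u, x). ennreal (H u x)) \<in> borel_measurable (lborel \<Otimes>\<^sub>M lborel)"
    unfolding H_def by measurable
  have H1: "(\<integral>\<^sup>+u. ennreal (H u x) \<partial>lborel) = ennreal (indicator {0<..} x * ((1 - exp (- l * x)) * (a / x * R x)))" for x
  proof (cases "x > 0")
    case True
    have "((\<lambda>u. exp (- u * x)) has_integral (- exp (- l * x) / x - (- exp (- 0 * x) / x))) {0..l}"
      using l True by (intro fundamental_theorem_of_calculus)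
        (auto intro!: derivative_eq_intros simp flip: has_real_derivative_iff_has_vector_derivative)
    hence "((\<lambda>u. exp (- u * x)) has_integral ((1 - exp (- l * x)) / x)) {0<..<l}"
      by (simp add: has_integral_Icc_iff_Ioo diff_divide_distrib)
    hence I: "(\<integral>\<^sup>+u. ennreal (indicator {0<..<l} u * exp (- u * x)) \<partial>lborel) = ennreal ((1 - exp (- l * x)) / x)"
      by (intro nn_integral_has_integral_lebesgue) auto
    have "(\<integral>\<^sup>+u. ennreal (H u x) \<partial>lborel) = (\<integral>\<^sup>+u. ennreal (a * R x) * ennreal (indicator {0<..<l} u * exp (- u * x)) \<partial>lborel)"
      using True R0[of x] a by (simp add: H_def mult_ac flip: ennreal_mult)
    also have "\<dots> = ennreal (a * R x) * ennreal ((1 - exp (- l * x)) / x)"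
      by (subst nn_integral_cmult) (measurable, simp only: I)
    finally show ?thesis
      using True R0[of x] a l by (simp add: mult_ac flip: ennreal_mult)
  qed (simp add: H_def)
  define h where "h u = a * u powr (a - 1) / (u powr a + c)" for u :: real
  have H2: "(\<integral>\<^sup>+x. ennreal (H u x) \<partial>lborel) = ennreal (indicator {0<..<l} u * h u)" for u
  proof (cases "0 < u \<and> u < l")
    case True
    have "(\<integral>\<^sup>+x. ennreal (H u x) \<partial>lborel) = (\<integral>\<^sup>+x. ennreal a * ennreal (indicator {0<..} x * (exp (- u * x) * R x)) \<partial>lborel)"
      using True a by (intro nn_integral_cong) (auto simp: H_def indicator_def ennreal_mult')
    also have "\<dots> = ennreal a * ennreal (u powr (a - 1) / (u powr a + c))"
      unfolding R_def using True by (subst nn_integral_cmult)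
        (use a in measurable, simp only: laplace_relaxation[OF a c])
    also have "\<dots> = ennreal (h u)" using a c by (simp add: h_def flip: ennreal_mult)
    finally show ?thesis using True by simp
  qed (auto simp: H_def)
  have "(\<integral>\<^sup>+x. ennreal (indicator {0<..} x * ((1 - exp (- l * x)) * (a / x * R x))) \<partial>lborel)
    = (\<integral>\<^sup>+x. \<integral>\<^sup>+u. ennreal (H u x) \<partial>lborel \<partial>lborel)" by (simp only: H1)
  also have "\<dots> = (\<integral>\<^sup>+u. \<integral>\<^sup>+x. ennreal (H u x) \<partial>lborel \<partial>lborel)"
    by (rule lborel_pair.Fubini') measurable
  also have "\<dots> = (\<integral>\<^sup>+u. ennreal (indicator {0<..<l} u * h u) \<partial>lborel)" by (simp only: H2)
  also have "\<dots> = ennreal (ln (1 + l powr a / c))"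
  proof (rule nn_integral_has_integral_lebesgue)
    \<comment> \<open>The derivative is singular at 0, so differentiability is used on the open
      interval and only continuity at the endpoints.\<close>
    have "(h has_integral (ln (1 + l powr a / c) - ln (1 + 0 powr a / c))) {0..l}"
    proof (rule fundamental_theorem_of_calculus_interior)
      show "continuous_on {0..l} (\<lambda>u. ln (1 + u powr a / c))"
        using a c by (intro continuous_intros continuous_on_powr') (auto simp: add_nonneg_eq_0_iff add_pos_nonneg less_imp_neq[THEN not_sym])
      fix u assume "u \<in> {0<..<l}"
      moreover from this have "1 + u powr a / c > 0" using c by (intro add_pos_nonneg) auto
      ultimately have "((\<lambda>u. ln (1 + u powr a / c)) has_real_derivative
          (a * u powr (a - 1) / c) / (1 + u powr a / c)) (at u)"
        using c by (auto intro!: derivative_eq_intros)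
      also have "1 + u powr a / c = (u powr a + c) / c" using c by (simp add: field_simps)
      finally have "((\<lambda>u. ln (1 + u powr a / c)) has_real_derivative h u) (at u)"
        using c by (simp add: h_def)
      thus "((\<lambda>u. ln (1 + u powr a / c)) has_vector_derivative h u) (at u)"
        by (simp add: has_real_derivative_iff_has_vector_derivative)
    qed (use l in auto)
    thus "(h has_integral ln (1 + l powr a / c)) {0<..<l}"
      by (simp add: has_integral_Icc_iff_Ioo)
  qed (use a c in \<open>auto simp: h_def intro!: divide_nonneg_pos add_nonneg_pos\<close>)
  finally show ?thesis by (simp add: R_def)
qed

section \<open>Finite measures determined by their moments\<close>

text \<open>Expand the exponential and integrate term by term; the bound on \<open>x\<close>
  dominates the norms by \<open>\<bar>t\<bar> ^ n / fact n\<close> times the total mass. Thus the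
  moments determine the Fourier transform.\<close>

lemma power_moments_sums_iexp:
  fixes M :: "real measure"
  assumes "finite_measure M" and [measurable_cong]: "sets M = sets borel"
    and bd: "AE x in M. \<bar>x\<bar> \<le> 1"
  shows "(\<lambda>n. (\<i> * complex_of_real t) ^ n / fact n * complex_of_real (\<integral>x. x ^ n \<partial>M))
    sums (CLINT x|M. iexp (t * x))"
proof -
  interpret finite_measure M by fact
  define f where "f n x = (\<i> * complex_of_real t) ^ n / fact n * complex_of_real (x ^ n)" for n and x :: real
  have int: "integrable M (\<lambda>x. x ^ n)" for n
    by (rule integrable_const_bound[where B = 1])
      (use bd in \<open>auto simp: power_abs power_le_one elim!: eventually_mono\<close>)
  have intf: "integrable M (f n)" for n
    unfolding f_def by (intro integrable_mult_right integrable_of_real int)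
  have sm: "summable (\<lambda>n. \<bar>u\<bar> ^ n / fact n)" for u :: real
    using summable_exp[of "\<bar>u\<bar>"] by (simp add: divide_inverse mult.commute)
  have norm_f: "norm (f n x) = \<bar>t\<bar> ^ n / fact n * \<bar>x\<bar> ^ n" for n x
    by (simp add: f_def norm_mult norm_divide norm_power power_abs)
  have s1: "summable (\<lambda>n. norm (f n x))" for x
    using sm[of "t * x"] by (simp add: norm_f abs_mult power_mult_distrib)
  have s2: "summable (\<lambda>n. \<integral>x. norm (f n x) \<partial>M)"
  proof (rule summable_comparison_test')
    show "summable (\<lambda>n. \<bar>t\<bar> ^ n / fact n * measure M (space M))"
      by (intro summable_mult2 sm)
    fix n
    have "(\<integral>x. norm (f n x) \<partial>M) \<le> (\<integral>x. \<bar>t\<bar> ^ n / fact n \<partial>M)"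
      using bd by (intro integral_mono_AE integrable_norm intf)
        (auto simp: norm_f power_le_one intro!: divide_right_mono mult_left_le elim!: eventually_mono)
    thus "norm (\<integral>x. norm (f n x) \<partial>M) \<le> \<bar>t\<bar> ^ n / fact n * measure M (space M)"
      by (simp add: mult.commute)
  qed
  have "(\<Sum>n. f n x) = iexp (t * x)" for x
    by (simp add: f_def exp_def scaleR_conv_of_real power_mult_distrib field_simps)
  moreover have "integral\<^sup>L M (f n) = (\<i> * complex_of_real t) ^ n / fact n * complex_of_real (\<integral>x. x ^ n \<partial>M)" for n
    unfolding f_def integral_mult_right_zero integral_complex_of_real ..
  ultimately show ?thesis
    using sums_integral[OF intf AE_I2[OF s1] s2] by simp
qed

text \<open>Equal moments give equal Fourier transforms. Levy's uniqueness theorem concerns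
  probability measures, so both measures are divided by their common mass \<open>m\<close>, the
  moment of order 0, and rescaled afterwards; mass 0 is a separate case.\<close>

lemma finite_measure_eqI_moments:
  fixes M N :: "real measure"
  assumes M: "finite_measure M" "sets M = sets borel" "AE x in M. \<bar>x\<bar> \<le> 1"
    and N: "finite_measure N" "sets N = sets borel" "AE x in N. \<bar>x\<bar> \<le> 1"
    and moments: "\<And>n. (\<integral>x. x ^ n \<partial>M) = (\<integral>x. x ^ n \<partial>N)"
  shows "M = N"
proof -
  interpret M: finite_measure M by fact
  interpret N: finite_measure N by fact
  have sp: "space M = UNIV" "space N = UNIV"
    using M(2) N(2) by (auto dest: sets_eq_imp_space_eq)
  define m where "m = measure M UNIV"
  have mN: "measure N UNIV = m" using moments[of 0] by (simp add: m_def sp)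
  have em: "emeasure M UNIV = ennreal m" "emeasure N UNIV = ennreal m"
    using M.emeasure_eq_measure N.emeasure_eq_measure mN by (simp_all add: m_def)
  show ?thesis
  proof (cases "m = 0")
    case True
    show ?thesis
    proof (rule measure_eqI)
      fix A assume "A \<in> sets M"
      have "emeasure M A \<le> emeasure M UNIV" "emeasure N A \<le> emeasure N UNIV"
        using M(2) N(2) by (auto intro!: emeasure_mono)
      thus "emeasure M A = emeasure N A" using em True by simp
    qed (use M N in simp)
  next
    case False
    hence m: "m > 0" by (simp add: m_def zero_less_measure_iff)
    have *: "real_distribution (density K (\<lambda>_. ennreal (1 / m)))"
      if "sets K = sets borel" "emeasure K UNIV = ennreal m" for K :: "real measure"
      unfolding real_distribution_def real_distribution_axioms_def
      using that m sets_eq_imp_space_eq[OF that(1)]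
      by (auto intro!: prob_spaceI simp: emeasure_density_const simp flip: ennreal_mult)
    have ch: "char (density K (\<lambda>_. ennreal (1 / m))) t = (1 / m) *\<^sub>R (CLINT x|K. iexp (t * x))"
      if "sets K = sets borel" for K :: "real measure" and t
    proof -
      have [measurable_cong]: "sets K = sets borel" by fact
      show ?thesis unfolding char_def using m by (subst integral_density) auto
    qed
    have "(CLINT x|M. iexp (t * x)) = (CLINT x|N. iexp (t * x))" for t
      using power_moments_sums_iexp[OF M, of t] power_moments_sums_iexp[OF N, of t]
      unfolding moments by (rule sums_unique2)
    hence "density M (\<lambda>_. ennreal (1 / m)) = density N (\<lambda>_. ennreal (1 / m))"
      by (intro Levy_uniqueness * M N em ext) (simp add: ch M N)
    hence "density (density M (\<lambda>_. ennreal (1 / m))) (\<lambda>_. ennreal m) =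
        density (density N (\<lambda>_. ennreal (1 / m))) (\<lambda>_. ennreal m)" by simp
    thus ?thesis
      using m by (simp add: density_density_eq density_1 flip: ennreal_mult)
  qed
qed

section \<open>Uniqueness of the Levy measure\<close>

text \<open>The integrand is at most 1 and at most \<open>l * x\<close>; adding the first bound
  times \<open>x\<close> to the second gives the majorant
  \<open>(1 + l) * (x / (1 + x))\<close>.\<close>

lemma integrable_one_minus_exp:
  assumes [measurable_cong]: "sets N = sets (restrict_space borel {0<..})"
    and fin: "(\<integral>\<^sup>+x. ennreal (x / (1 + x)) \<partial>N) < \<infinity>" and l: "l > 0"
  shows "integrable N (\<lambda>x :: real. 1 - exp (- l * x))"
proof -
  have sp: "space N = {0<..}" using sets_eq_imp_space_eq[OF assms(1)] by (simp add: space_restrict_space)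
  have [measurable]: "(\<lambda>x::real. x) \<in> borel_measurable N"
    by (simp add: measurable_cong_sets[OF assms(1) refl] measurable_restrict_space1)
  have "integrable N (\<lambda>x. (1 + l) * (x / (1 + x)))"
  proof (intro integrable_mult_right integrableI_bounded)
    have "(\<integral>\<^sup>+x. ennreal (norm (x / (1 + x))) \<partial>N) = (\<integral>\<^sup>+x. ennreal (x / (1 + x)) \<partial>N)"
      by (intro nn_integral_cong) (auto simp: sp)
    thus "(\<integral>\<^sup>+x. ennreal (norm (x / (1 + x))) \<partial>N) < \<infinity>" using fin by simp
  qed measurable
  thus ?thesis
  proof (rule Bochner_Integration.integrable_bound)
    show "AE x in N. norm (1 - exp (- l * x)) \<le> norm ((1 + l) * (x / (1 + x)))"
    proof (rule AE_I2)
      fix x assume "x \<in> space N"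
      hence x: "x > 0" by (simp add: sp)
      have "1 - exp (- l * x) \<le> 1" "1 - exp (- l * x) \<le> l * x"
        using exp_ge_add_one_self[of "- l * x"] by auto
      hence "(1 - exp (- l * x)) + x * (1 - exp (- l * x)) \<le> l * x + x * 1"
        using x by (intro add_mono mult_left_mono) auto
      hence "1 - exp (- l * x) \<le> (1 + l) * (x / (1 + x))"
        using x by (simp add: field_simps)
      thus "norm (1 - exp (- l * x)) \<le> norm ((1 + l) * (x / (1 + x)))"
        using x l by simp
    qed
  qed measurable
qed

text \<open>The identity \<open>(1 - exp (- x)) * exp (- x) ^ n = (1 - exp (- (n + 1) * x)) - (1 -
  exp (- n * x))\<close> makes the moments of \<open>P K\<close> depend on \<open>f\<close> alone,
  and \<open>K\<close> can be recovered from \<open>P K\<close>.\<close>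

lemma levy_measure_unique:
  assumes "levy_measure_of_exponent f N" "levy_measure_of_exponent f N'"
  shows "N = N'"
proof -
  define P where "P K = distr (density K (\<lambda>x. ennreal (1 - exp (- x)))) borel (\<lambda>x. exp (- x))"
    for K :: "real measure"
  \<comment> \<open>This inverts \<open>x \<mapsto> exp (- x)\<close>; the value 1 elsewhere only
    keeps the range inside \<open>{0<..}\<close>, as \<open>P K\<close> lives on the open unit
    interval.\<close>
  define T' where "T' y = (if 0 < y \<and> y < 1 then - ln y else 1)" for y :: real
  \<comment> \<open>For \<open>n = 0\<close> the subtracted term is set to 0, because
    \<open>f\<close> is prescribed only at positive arguments. The last conjunct undoes the
    construction: divide by the weight, which is \<open>1 - y\<close> in the new variable, and map
    back.\<close>
  have key: "finite_measure (P K) \<and> (AE y in P K. \<bar>y\<bar> \<le> 1) \<and>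
     (\<forall>n. (\<integral>y. y ^ n \<partial>P K) = f (real n + 1) - (if n = 0 then 0 else f (real n))) \<and>
     distr (density (P K) (\<lambda>y. ennreal (1 / (1 - y)))) (restrict_space borel {0<..}) T' = K"
    if "levy_measure_of_exponent f K" for K
  proof -
    have sets: "sets K = sets (restrict_space borel {0<..})"
      and fin: "(\<integral>\<^sup>+x. ennreal (x / (1 + x)) \<partial>K) < \<infinity>"
      and feq: "\<And>l. l > 0 \<Longrightarrow> f l = (\<integral>x. (1 - exp (- l * x)) \<partial>K)"
      using that by (auto simp: levy_measure_of_exponent_def)
    note [measurable_cong] = sets
    have sp: "space K = {0<..}" using sets_eq_imp_space_eq[OF sets] by (simp add: space_restrict_space)
    have [measurable]: "(\<lambda>x::real. x) \<in> borel_measurable K"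
      by (simp add: measurable_cong_sets[OF sets refl] measurable_restrict_space1)
    note int = integrable_one_minus_exp[OF sets fin]
    have "emeasure (P K) (space (P K)) = emeasure (density K (\<lambda>x. ennreal (1 - exp (- x)))) (space K)"
      unfolding P_def by (subst emeasure_distr) auto
    also have "\<dots> = (\<integral>\<^sup>+x. ennreal (1 - exp (- x)) \<partial>K)"
      by (subst emeasure_density) (auto intro!: nn_integral_cong)
    also have "\<dots> = ennreal (\<integral>x. 1 - exp (- x) \<partial>K)"
      using int[of 1] by (intro nn_integral_eq_integral AE_I2) (auto simp: sp)
    finally have "finite_measure (P K)" by (intro finite_measureI) simp
    moreover have "AE y in P K. \<bar>y\<bar> \<le> 1"
      unfolding P_def by (subst AE_distr_iff) (auto simp: AE_density sp intro!: AE_I2)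
    moreover have "(\<integral>y. y ^ n \<partial>P K) = f (real n + 1) - (if n = 0 then 0 else f (real n))" for n
    proof -
      have "(\<integral>y. y ^ n \<partial>P K) = (\<integral>x. (1 - exp (- x)) * exp (- x) ^ n \<partial>K)"
        unfolding P_def by (subst integral_distr, simp, simp, subst integral_density) (auto simp: sp intro!: AE_I2)
      also have "\<dots> = (\<integral>x. (1 - exp (- (real n + 1) * x)) - (1 - exp (- real n * x)) \<partial>K)"
      proof (intro Bochner_Integration.integral_cong refl)
        fix x
        have n: "exp (- real n * x) = exp (- x) ^ n"
          using exp_of_nat_mult[of n "- x"] by simp
        have "exp (- (real n + 1) * x) = exp (- x) * exp (- real n * x)"
          by (simp add: mult_exp_exp algebra_simps)
        thus "(1 - exp (- x)) * exp (- x) ^ n = (1 - exp (- (real n + 1) * x)) - (1 - exp (- real n * x))"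
          unfolding n by (simp add: algebra_simps)
      qed
      also have "\<dots> = f (real n + 1) - (if n = 0 then 0 else f (real n))"
      proof (cases "n = 0")
        case False
        hence "0 < real n" "0 < real n + 1" by auto
        with False show ?thesis
          by (simp only: feq int Bochner_Integration.integral_diff if_False)
      qed (use feq[of 1] in simp)
      finally show ?thesis .
    qed
    moreover have "distr (density (P K) (\<lambda>y. ennreal (1 / (1 - y)))) (restrict_space borel {0<..}) T' = K"
    proof -
      have T': "T' \<in> borel \<rightarrow>\<^sub>M restrict_space borel {0<..}"
        unfolding T'_def by (intro measurable_restrict_space2) (auto simp: Pi_def)
      let ?D = "density K (\<lambda>x. ennreal (1 - exp (- x)))"
      have "distr (density (P K) (\<lambda>y. ennreal (1 / (1 - y)))) (restrict_space borel {0<..}) T' =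
         distr (density (distr ?D borel (\<lambda>x. exp (- x))) (\<lambda>y. ennreal (1 / (1 - y)))) ?D T'"
        unfolding P_def by (rule distr_cong) (auto simp: sets)
      \<comment> \<open>On \<open>{0<..}\<close> the map \<open>T'\<close> is a left inverse of
        \<open>x \<mapsto> exp (- x)\<close>, so the two image measures collapse; the densities then
        cancel because \<open>1 - exp (- x)\<close> is nonzero for \<open>x > 0\<close>.\<close>
      also have "\<dots> = density ?D ((\<lambda>y. ennreal (1 / (1 - y))) \<circ> (\<lambda>x. exp (- x)))"
        using T' by (intro distr_density_distr)
          (auto simp: sp T'_def measurable_cong_sets[OF refl sets])
      also have "\<dots> = density K (\<lambda>x. ennreal (1 - exp (- x)) * ennreal (1 / (1 - exp (- x))))"
        by (simp add: comp_def density_density_eq)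
      also have "\<dots> = density K (\<lambda>_. 1)"
        by (intro density_cong AE_I2) (auto simp: sp simp flip: ennreal_mult)
      finally show ?thesis by (simp add: density_1)
    qed
    ultimately show ?thesis by blast
  qed
  have "P N = P N'"
    using key[OF assms(1)] key[OF assms(2)]
    by (intro finite_measure_eqI_moments) (auto simp: P_def)
  thus ?thesis using key[OF assms(1)] key[OF assms(2)] by metis
qed

section \<open>Identification of the Levy measure\<close>

text \<open>The finiteness condition follows from the exponent at \<open>l = 1\<close>, since
  \<open>1 + x \<le> exp x\<close> gives \<open>x / (1 + x) \<le> 1 - exp (- x)\<close>.
  Nonnegativity turns the extended integral into the Bochner one.\<close>

lemma levy_measure_relaxation:
  assumes a: "0 < a" "a < 1" and c: "c > 0"
  shows "levy_measure_of_exponent (\<lambda>l. ln (1 + l powr a / c))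
    (density (restrict_space lborel {0<..}) (\<lambda>x. ennreal (a / x * relaxation a c x)))"
    (is "levy_measure_of_exponent _ ?N")
proof -
  have [measurable]: "relaxation a c \<in> borel_measurable borel" using a by measurable
  have sets: "sets ?N = sets (restrict_space borel {0<..})"
    by (simp add: sets_restrict_space)
  have sp: "space ?N = {0<..}" by (simp add: space_restrict_space)
  have nn: "(\<integral>\<^sup>+x. ennreal (1 - exp (- l * x)) \<partial>?N) = ennreal (ln (1 + l powr a / c))" if l: "l > 0" for l
  proof -
    have "(\<integral>\<^sup>+x. ennreal (1 - exp (- l * x)) \<partial>?N) =
        (\<integral>\<^sup>+x. ennreal (a / x * relaxation a c x) * ennreal (1 - exp (- l * x)) * indicator {0<..} x \<partial>lborel)"
      by (subst nn_integral_density) (auto simp: nn_integral_restrict_space intro!: measurable_restrict_space1)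
    also have "\<dots> = (\<integral>\<^sup>+x. ennreal (indicator {0<..} x * ((1 - exp (- l * x)) * (a / x * relaxation a c x))) \<partial>lborel)"
      using a c l relaxation_pos[of a c]
      by (intro nn_integral_cong) (auto simp: indicator_def mult.commute less_imp_le simp flip: ennreal_mult)
    finally show ?thesis using nn_integral_levy_relaxation[OF a c l] by simp
  qed
  have ln_nonneg: "0 \<le> ln (1 + l powr a / c)" for l using c by simp
  have "(\<integral>\<^sup>+x. ennreal (x / (1 + x)) \<partial>?N) \<le> (\<integral>\<^sup>+x. ennreal (1 - exp (- 1 * x)) \<partial>?N)"
  proof (intro nn_integral_mono ennreal_leI)
    fix x assume "x \<in> space ?N"
    hence x: "x > 0" by (simp add: sp)
    hence "exp (- x) \<le> inverse (1 + x)"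
      using exp_ge_add_one_self[of x] by (simp add: exp_minus le_imp_inverse_le)
    also have "inverse (1 + x) = 1 - x / (1 + x)" using x by (simp add: field_simps)
    finally show "x / (1 + x) \<le> 1 - exp (- 1 * x)" by simp
  qed
  also have "\<dots> < \<infinity>" by (subst nn) auto
  finally have "(\<integral>\<^sup>+x. ennreal (x / (1 + x)) \<partial>?N) < \<infinity>" .
  moreover have "ln (1 + l powr a / c) = (\<integral>x. 1 - exp (- l * x) \<partial>?N)" if l: "l > 0" for l
  proof -
    have "(\<lambda>x. 1 - exp (- l * x)) \<in> borel_measurable ?N"
      by (auto intro!: measurable_restrict_space1)
    moreover have "AE x in ?N. 0 \<le> 1 - exp (- l * x)"
      using l by (intro AE_I2) (simp only: sp, simp)
    ultimately show ?thesis
      using nn[OF l] ln_nonneg by (subst integral_eq_nn_integral) (simp_all only: nn enn2real_ennreal l)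
  qed
  ultimately show ?thesis unfolding levy_measure_of_exponent_def using sets by blast
qed

theorem lemma12:
  fixes M :: "'a measure" and G :: "real \<Rightarrow> 'a \<Rightarrow> real"
    and b :: real and \<alpha> :: "real \<Rightarrow> real" and \<nu> :: "real \<Rightarrow> real measure"
  assumes "b > 0"
    and "continuous_on {0..} \<alpha>"
    and "\<And>t. t \<ge> 0 \<Longrightarrow> 0 < \<alpha> t \<and> \<alpha> t < 1"
    and "inhom_geometric_stable_subordinator M b \<alpha> G"
  shows "time_dependent_levy_measure M G (geometric_stable_exponent b \<alpha>) \<nu> \<longleftrightarrow>
    (\<forall>t\<ge>0. \<nu> t = density (restrict_space lborel {0<..})
       (\<lambda>x. ennreal (\<alpha> t / x * mittag_leffler (\<alpha> t) (- (x powr \<alpha> t) / b))))"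
proof -
  define N where "N t = density (restrict_space lborel {0<..})
       (\<lambda>x. ennreal (\<alpha> t / x * mittag_leffler (\<alpha> t) (- (x powr \<alpha> t) / b)))" for t
  have "levy_measure_of_exponent (geometric_stable_exponent b \<alpha> t) (N t)" if "t \<ge> 0" for t
  proof -
    have "levy_measure_of_exponent (\<lambda>l. ln (1 + l powr \<alpha> t / (1 / b)))
      (density (restrict_space lborel {0<..}) (\<lambda>x. ennreal (\<alpha> t / x * relaxation (\<alpha> t) (1 / b) x)))"
      using assms(1) assms(3)[OF that] by (intro levy_measure_relaxation) auto
    thus ?thesis
      by (simp add: N_def relaxation_def geometric_stable_exponent_def[abs_def] mult.commute)
  qed
  \<comment> \<open>With \<open>c = 1 / b\<close> existence is settled by \<open>N t\<close>;
    uniqueness upgrades it to an equivalence, which yields both directions of the theorem.\<close>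
  hence "levy_measure_of_exponent (geometric_stable_exponent b \<alpha> t) K \<longleftrightarrow> K = N t" if "t \<ge> 0" for t K
    using that levy_measure_unique by blast
  moreover have "has_laplace_exponent M G (geometric_stable_exponent b \<alpha>)"
    using assms(4) by (simp add: inhom_geometric_stable_subordinator_def)
  ultimately show ?thesis
    by (simp add: time_dependent_levy_measure_def N_def)
qed

end
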